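(* Let $P$ be any pattern on $k$ vertices. There exists a reduction that maps every ordered graph $(G,\tau)$ with $n$ vertices to a graph $G'$ with $kn$ vertices such that $(G,\tau)$ contains $P$ if and only if $G'$ contains a clique on $k$ vertices.
   Context: A pattern $P$ consists of a finite totally ordered vertex set $V(P)$ together with a partition of the unordered pairs of distinct vertices into mandatory edges $M(P)$, forbidden edges $F(P)$ and undecided pairs $U(P)$ (the pattern need not be fully specified, i.e. $U(P)$ may be nonempty). An ordered graph $(G,\tau)$ is a finite simple graph with a total order $\tau$ on its vertices. $(G,\tau)$ contains $P$ if there is $X\subseteq V(G)$ with $|X|=|V(P)|$ such that, identifying $X$ with $V(P)$ via the order-preserving bijection, all pairs of $M(P)$ are edges and all pairs of $F(P)$ are non-edges of $G$. *)

theory Defs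
  imports Main "HOL-Library.Ramsey"
begin

section \<open>Graphs, ordered graphs and patterns\<close>

record 'a graph =
  verts :: "'a set"
  edges :: "'a set set"

record 'a ordered_graph = "'a graph" +
  vord :: "'a rel"

record 'p pattern =
  pverts :: "'p set"
  pord :: "'p rel"
  mandatory :: "'p set set"
  forbidden :: "'p set set"
  undecided :: "'p set set"

definition simple_graph :: "('a, 'z) graph_scheme \<Rightarrow> bool" where
  "simple_graph G \<longleftrightarrow> finite (verts G) \<and> edges G \<subseteq> [verts G]\<^bsup>2\<^esup>"

definition is_ordered_graph :: "'a ordered_graph \<Rightarrow> bool" where
  "is_ordered_graph G \<longleftrightarrow> simple_graph G \<and> linear_order_on (verts G) (vord G)"

definition is_pattern :: "'p pattern \<Rightarrow> bool" where
  "is_pattern P \<longleftrightarrow>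
     finite (pverts P) \<and> linear_order_on (pverts P) (pord P) \<and>
     mandatory P \<union> forbidden P \<union> undecided P = [pverts P]\<^bsup>2\<^esup> \<and>
     mandatory P \<inter> forbidden P = {} \<and>
     mandatory P \<inter> undecided P = {} \<and>
     forbidden P \<inter> undecided P = {}"

definition contains_pattern :: "'a ordered_graph \<Rightarrow> 'p pattern \<Rightarrow> bool" where
  "contains_pattern G P \<longleftrightarrow>
     (\<exists>X \<subseteq> verts G. card X = card (pverts P) \<and>
       (\<exists>f. bij_betw f (pverts P) X \<and>
            (\<forall>p\<in>pverts P. \<forall>q\<in>pverts P. (p, q) \<in> pord P \<longleftrightarrow> (f p, f q) \<in> vord G) \<and>
            (\<forall>e\<in>mandatory P. f ` e \<in> edges G) \<and>
            (\<forall>e\<in>forbidden P. f ` e \<notin> edges G)))"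

definition contains_clique :: "('a, 'z) graph_scheme \<Rightarrow> nat \<Rightarrow> bool" where
  "contains_clique G k \<longleftrightarrow> (\<exists>K \<subseteq> verts G. card K = k \<and> clique K (edges G))"


section \<open>A random access machine\<close>

text \<open>
  Structured programs for a unit-cost random access machine. A state consists of registers and of
  an addressable memory, both holding natural numbers. In a program the register names are
  constants, so a program uses a fixed finite number of registers. The only instruction that
  produces a value exceeding all earlier ones (apart from the constants of the program) is
  the increment; hence all values stay bounded by the input values plus the constants plus the
  running time, and the unit cost measure cannot be abused by computing with huge numbers.
\<close>

type_synonym state = "(nat \<Rightarrow> nat) \<times> (nat \<Rightarrow> nat)"

datatype com =
    SKIP
  | CONSTANT nat nat
  | MOVE nat nat
  | INC nat
  | SUB nat nat nat
  | LOAD nat nat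
  | STORE nat nat
  | SEQ com com
  | IFPOS nat com com
  | WHILEPOS nat com

text \<open>
  \<open>exec c s t s'\<close>: program \<open>c\<close>, started in state \<open>s\<close>, halts in state \<open>s'\<close> after \<open>t\<close> steps.
  Subtraction is truncated at \<open>0\<close>.
\<close>

inductive exec :: "com \<Rightarrow> state \<Rightarrow> nat \<Rightarrow> state \<Rightarrow> bool" where
  Skip: "exec SKIP s 1 s"
| Const: "exec (CONSTANT r a) (R, M) 1 (R(r := a), M)"
| Move: "exec (MOVE r x) (R, M) 1 (R(r := R x), M)"
| Inc: "exec (INC r) (R, M) 1 (R(r := R r + 1), M)"
| Sub: "exec (SUB r x y) (R, M) 1 (R(r := R x - R y), M)"
| Load: "exec (LOAD r x) (R, M) 1 (R(r := M (R x)), M)"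
| Store: "exec (STORE x r) (R, M) 1 (R, M(R x := R r))"
| Seq: "exec c s t s' \<Longrightarrow> exec d s' u s'' \<Longrightarrow> exec (SEQ c d) s (t + u) s''"
| IfTrue: "0 < fst s r \<Longrightarrow> exec c s t s' \<Longrightarrow> exec (IFPOS r c d) s (1 + t) s'"
| IfFalse: "fst s r = 0 \<Longrightarrow> exec d s t s' \<Longrightarrow> exec (IFPOS r c d) s (1 + t) s'"
| WhileTrue: "0 < fst s r \<Longrightarrow> exec c s t s' \<Longrightarrow> exec (WHILEPOS r c) s' u s'' \<Longrightarrow>
    exec (WHILEPOS r c) s (1 + t + u) s''"
| WhileFalse: "fst s r = 0 \<Longrightarrow> exec (WHILEPOS r c) s 1 s"

inductive_cases exec_elims:
  "exec SKIP s t s'" "exec (CONSTANT r a) s t s'" "exec (MOVE r x) s t s'" "exec (INC r) s t s'"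
  "exec (SUB r x y) s t s'" "exec (LOAD r x) s t s'" "exec (STORE x r) s t s'"
  "exec (SEQ c d) s t s'" "exec (IFPOS r c d) s t s'" "exec (WHILEPOS r c) s t s'"

lemma exec_deterministic:
  "exec c s t s1 \<Longrightarrow> exec c s t' s2 \<Longrightarrow> t = t' \<and> s1 = s2"
proof (induction arbitrary: t' s2 rule: exec.induct)
  case (Seq c s a m d b s1 t' s2)
  from Seq.prems show ?case
    by (rule exec_elims(8)) (use Seq.IH in blast)
next
  case (WhileTrue s r c a m b s1 t' s2)
  from WhileTrue.prems show ?case
  proof (rule exec_elims(10))
    fix a' m' b'
    assume *: "t' = Suc (a' + b')" "exec c s a' m'" "exec (WHILEPOS r c) m' b' s2"
    from WhileTrue.IH(1)[OF *(2)] WhileTrue.IH(2) *(1,3) show ?case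
      by simp
  qed (use WhileTrue.hyps(1) in simp)
next
  case (IfTrue s r c a s1 d t' s2)
  from IfTrue.prems show ?case
    by (rule exec_elims(9)) (use IfTrue.hyps(1) IfTrue.IH in auto)
next
  case (IfFalse s r d a s1 c t' s2)
  from IfFalse.prems show ?case
    by (rule exec_elims(9)) (use IfFalse.hyps(1) IfFalse.IH in auto)
next
  case (WhileFalse s r c t' s2)
  from WhileFalse.prems show ?case
    by (rule exec_elims(10)) (use WhileFalse.hyps in auto)
next
  case Skip then show ?case by (rule exec_elims(1)) simp
next
  case Const then show ?case by (rule exec_elims(2)) simp
next
  case Move then show ?case by (rule exec_elims(3)) simp
next
  case Inc then show ?case by (rule exec_elims(4)) simp
next
  case Sub then show ?case by (rule exec_elims(5)) simp
next
  case Load then show ?case by (rule exec_elims(6)) simp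
next
  case Store then show ?case by (rule exec_elims(7)) simp
qed


section \<open>Reductions\<close>

definition enumerates :: "'a list \<Rightarrow> 'a set \<Rightarrow> bool" where
  "enumerates vs V \<longleftrightarrow> distinct vs \<and> set vs = V"

definition adj_bit :: "('a, 'z) graph_scheme \<Rightarrow> 'a \<Rightarrow> 'a \<Rightarrow> nat" where
  "adj_bit G u v = (if {u, v} \<in> edges G then 1 else 0)"

text \<open>
  The input format: register \<open>0\<close> holds the number \<open>n\<close> of vertices, and the memory holds row by row,
  from address \<open>0\<close> on, the \<open>n \<times> n\<close> adjacency matrix of \<open>G\<close> with respect to the enumeration \<open>vs\<close> of
  the vertices. Everything else is \<open>0\<close>.
\<close>

definition input_state :: "('a, 'z) graph_scheme \<Rightarrow> 'a list \<Rightarrow> state" where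
  "input_state G vs =
     (let n = length vs in
       ((\<lambda>r. if r = 0 then n else 0),
        (\<lambda>a. if a < n * n then adj_bit G (vs ! (a div n)) (vs ! (a mod n)) else 0)))"

text \<open>
  The output format: register \<open>0\<close> holds the number \<open>N\<close> of vertices, and the \<open>N \<times> N\<close> adjacency
  matrix with respect to some enumeration of the vertices is stored row by row from the address
  in register \<open>1\<close> on.
\<close>

definition output_state :: "state \<Rightarrow> ('b, 'z) graph_scheme \<Rightarrow> bool" where
  "output_state s H \<longleftrightarrow>
     (\<exists>ws. enumerates ws (verts H) \<and> fst s 0 = length ws \<and>
        (\<forall>i < length ws. \<forall>j < length ws.
           snd s (fst s 1 + i * length ws + j) = adj_bit H (ws ! i) (ws ! j)))"

text \<open>
  A reduction is a map from ordered graphs to graphs that is computed by a single program in time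
  \<open>O(n\<^sup>2)\<close>, that is, linear in the size of the adjacency matrix given as input. An ordered
  graph is presented by listing its vertices increasingly with respect to its order. The time bound
  matters: for a fixed pattern, containment itself can be decided in polynomial time by
  exhaustive search.
\<close>

definition reduction :: "('a ordered_graph \<Rightarrow> 'b graph) \<Rightarrow> bool" where
  "reduction \<rho> \<longleftrightarrow>
     (\<forall>G. is_ordered_graph G \<longrightarrow> simple_graph (\<rho> G)) \<and>
     (\<exists>c C. \<forall>G vs. is_ordered_graph G \<longrightarrow> enumerates vs (verts G) \<longrightarrow>
        sorted_wrt (\<lambda>u v. (u, v) \<in> vord G) vs \<longrightarrow>
        (\<exists>t s. exec c (input_state G vs) t s \<and> output_state s (\<rho> G) \<and>
               t \<le> C * ((card (verts G))\<^sup>2 + 1)))"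

end

theory Submission
  imports Defs
begin

text \<open>
  The vertices of \<open>G'\<close> are the pairs of a position \<open>p\<close> in \<open>P\<close> and a position \<open>a\<close> in \<open>G\<close>; two pairs
  with \<open>p < q\<close> are adjacent iff \<open>a < b\<close> and the adjacency of \<open>a\<close> and \<open>b\<close> in \<open>G\<close> respects what \<open>P\<close>
  demands of \<open>p\<close> and \<open>q\<close>. Pairs with the same \<open>p\<close> are never adjacent, so a clique on \<open>k\<close> vertices
  picks one \<open>a\<close> for each of the \<open>k\<close> positions of \<open>P\<close>, monotonically, which is an occurrence of \<open>P\<close>.
  For fixed \<open>P\<close> the loops over \<open>p\<close> and \<open>q\<close> can be unrolled, which leaves \<open>k\<^sup>2\<close> passes over the
  adjacency matrix of \<open>G\<close>; writing the output row by row needs no multiplication.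
\<close>

section \<open>Time-bounded Hoare triples\<close>

text \<open>Total correctness: the triple asserts a halting run, and \<open>T\<close> bounds its
  number of steps. As \<open>exec\<close> is deterministic, this is the only run.\<close>

definition hoare ::
    "((nat \<Rightarrow> nat) \<Rightarrow> (nat \<Rightarrow> nat) \<Rightarrow> bool) \<Rightarrow> com \<Rightarrow> nat \<Rightarrow>
     ((nat \<Rightarrow> nat) \<Rightarrow> (nat \<Rightarrow> nat) \<Rightarrow> bool) \<Rightarrow> bool" where
  "hoare P c T Q \<longleftrightarrow>
     (\<forall>R M. P R M \<longrightarrow> (\<exists>t R' M'. exec c (R, M) t (R', M') \<and> t \<le> T \<and> Q R' M'))"

lemma hoareE:
  assumes "hoare P c T Q" and "P R M"
  obtains t R' M' where "exec c (R, M) t (R', M')" and "t \<le> T" and "Q R' M'"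
  using assms unfolding hoare_def by blast

lemma hoare_conseq:
  assumes "hoare P c T Q"
    and "\<And>R M. P' R M \<Longrightarrow> P R M" and "T \<le> T'" and "\<And>R M. Q R M \<Longrightarrow> Q' R M"
  shows "hoare P' c T' Q'"
  using assms unfolding hoare_def by (meson le_trans)

lemma hoare_strengthen_pre:
  assumes "hoare P c T Q" and "\<And>R M. P' R M \<Longrightarrow> P R M" and "T \<le> T'"
  shows "hoare P' c T' Q"
  using assms by (rule hoare_conseq)

lemma hoare_SKIP: "hoare Q SKIP 1 Q"
  unfolding hoare_def by (blast intro: exec.intros)

text \<open>The instruction rules compute the precondition from an arbitrary \<open>Q\<close>, so
  straight-line code is processed backwards by resolution.\<close>

lemma hoare_CONSTANT: "hoare (\<lambda>R. Q (R(r := a))) (CONSTANT r a) 1 Q"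
  unfolding hoare_def by (blast intro: exec.intros)

lemma hoare_MOVE: "hoare (\<lambda>R. Q (R(r := R x))) (MOVE r x) 1 Q"
  unfolding hoare_def by (blast intro: exec.intros)

lemma hoare_INC: "hoare (\<lambda>R. Q (R(r := R r + 1))) (INC r) 1 Q"
  unfolding hoare_def by (blast intro: exec.intros)

lemma hoare_SUB: "hoare (\<lambda>R. Q (R(r := R x - R y))) (SUB r x y) 1 Q"
  unfolding hoare_def by (blast intro: exec.intros)

lemma hoare_LOAD: "hoare (\<lambda>R M. Q (R(r := M (R x))) M) (LOAD r x) 1 Q"
  unfolding hoare_def by (blast intro: exec.intros)

lemma hoare_STORE: "hoare (\<lambda>R M. Q R (M(R x := R r))) (STORE x r) 1 Q"
  unfolding hoare_def by (blast intro: exec.intros)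

text \<open>The premise on the second program comes first: resolving it against the known
  postcondition fixes the intermediate assertion \<open>Q\<close>.\<close>

lemma hoare_SEQ:
  assumes "hoare Q d U S" and "hoare P c T Q"
  shows "hoare P (SEQ c d) (T + U) S"
  using assms unfolding hoare_def by (meson exec.Seq add_mono)

text \<open>Adding the bounds of both branches instead of taking their maximum is coarse but
  harmless, since constant factors do not matter.\<close>

lemma hoare_IFPOS:
  assumes "hoare P c T S" and "hoare Q d U S"
  shows "hoare (\<lambda>R M. if 0 < R r then P R M else Q R M) (IFPOS r c d) (1 + (T + U)) S"
  unfolding hoare_def
proof (intro allI impI)
  fix R M
  assume pre: "if 0 < R r then P R M else Q R M"
  show "\<exists>t R' M'. exec (IFPOS r c d) (R, M) t (R', M') \<and> t \<le> 1 + (T + U) \<and> S R' M'"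
  proof (cases "0 < R r")
    case True
    then obtain t R' M' where "exec c (R, M) t (R', M')" "t \<le> T" "S R' M'"
      using assms(1) pre unfolding hoare_def by fastforce
    moreover have "exec (IFPOS r c d) (R, M) (1 + t) (R', M')"
      using True calculation by (intro exec.IfTrue) auto
    ultimately show ?thesis by (meson add_left_mono le_add1 le_trans)
  next
    case False
    then obtain t R' M' where "exec d (R, M) t (R', M')" "t \<le> U" "S R' M'"
      using assms(2) pre unfolding hoare_def by fastforce
    moreover have "exec (IFPOS r c d) (R, M) (1 + t) (R', M')"
      using False calculation by (intro exec.IfFalse) auto
    ultimately show ?thesis by (meson add_left_mono le_add2 le_trans)
  qed
qed

text \<open>The index is known when the program is built, so the copies may be different programs.
  This is how the pattern enters the code.\<close>

fun unroll :: "(nat \<Rightarrow> com) \<Rightarrow> nat \<Rightarrow> com" where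
  "unroll c 0 = SKIP"
| "unroll c (Suc m) = SEQ (unroll c m) (c m)"

lemma hoare_unroll:
  assumes "\<And>j. j < m \<Longrightarrow> hoare (I j) (c j) T (I (Suc j))"
  shows "hoare (I 0) (unroll c m) (m * T + 1) (I m)"
  using assms
proof (induction m)
  case 0
  show ?case using hoare_SKIP[of "I 0"] by simp
next
  case (Suc m)
  have "hoare (I 0) (SEQ (unroll c m) (c m)) ((m * T + 1) + T) (I (Suc m))"
    by (rule hoare_SEQ[where Q = "I m"]) (use Suc in auto)
  then show ?case by (simp add: algebra_simps)
qed

text \<open>
  The counter \<open>i\<close> runs from \<open>0\<close> to \<open>R l - 1\<close>. The scratch register \<open>z\<close> is recomputed after each
  pass, so nested loops may share it.
\<close>

definition FOR :: "nat \<Rightarrow> nat \<Rightarrow> nat \<Rightarrow> com \<Rightarrow> com" where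
  "FOR z i l c =
     SEQ (CONSTANT i 0) (SEQ (MOVE z l) (WHILEPOS z (SEQ c (SEQ (INC i) (SUB z l i)))))"

text \<open>The body may destroy \<open>z\<close>, but must keep the counter and the bound; the
  invariant must not depend on \<open>i\<close> or \<open>z\<close>. A pass costs 3 steps beyond the
  body (test, \<open>INC\<close>, \<open>SUB\<close>); the final 3 are the two initialisations and
  the failing test.\<close>

lemma hoare_FOR:
  assumes body: "\<And>j. j < N \<Longrightarrow>
      hoare (\<lambda>R M. I j R M \<and> R i = j \<and> R l = N) c T (\<lambda>R M. I (Suc j) R M \<and> R i = j \<and> R l = N)"
    and frame: "\<And>j R M u v. I j R M \<Longrightarrow> I j (R(i := u, z := v)) M"
    and regs: "i \<noteq> l" "z \<noteq> l" "z \<noteq> i"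
  shows "hoare (\<lambda>R M. I 0 R M \<and> R l = N) (FOR z i l c) (N * (T + 3) + 3)
           (\<lambda>R M. I N R M \<and> R l = N)"
proof -
  let ?b = "SEQ c (SEQ (INC i) (SUB z l i))"
  \<comment> \<open>Generalised to \<open>j\<close> completed passes, for an induction on the number
    \<open>N - j\<close> of passes left, which is also the content of \<open>z\<close>.\<close>
  have while: "\<exists>t R' M'. exec (WHILEPOS z ?b) (R, M) t (R', M') \<and> t \<le> (N - j) * (T + 3) + 1 \<and>
      I N R' M' \<and> R' l = N"
    if "I j R M" "R i = j" "R l = N" "R z = N - j" "j \<le> N" for j R M
    using that
  proof (induction "N - j" arbitrary: j R M)
    case 0
    then have "exec (WHILEPOS z ?b) (R, M) 1 (R, M)" by (intro exec.WhileFalse) simp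
    moreover have "I N R M" using 0 by simp
    ultimately show ?case using 0 by (metis le_add2)
  next
    case (Suc d)
    then have j: "j < N" by simp
    obtain t R1 M1 where c: "exec c (R, M) t (R1, M1)" "t \<le> T"
      and R1: "I (Suc j) R1 M1" "R1 i = j" "R1 l = N"
      using body[OF j] Suc.prems unfolding hoare_def by blast
    define R2 where "R2 = R1(i := R1 i + 1, z := N - Suc j)"
    have "exec (INC i) (R1, M1) 1 (R1(i := R1 i + 1), M1)" by (rule exec.Inc)
    moreover have "exec (SUB z l i) (R1(i := R1 i + 1), M1) 1 (R2, M1)"
      using exec.Sub[of z l i "R1(i := R1 i + 1)" M1] R1 regs by (simp add: R2_def)
    ultimately have b: "exec ?b (R, M) (t + (1 + 1)) (R2, M1)"
      using c(1) by (intro exec.Seq)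
    have "I (Suc j) R2 M1" unfolding R2_def by (rule frame) (rule R1)
    moreover have "d = N - Suc j" "R2 i = Suc j" "R2 l = N" "R2 z = N - Suc j" "Suc j \<le> N"
      using Suc.hyps(2) R1 regs j by (auto simp: R2_def)
    ultimately obtain u R' M' where w: "exec (WHILEPOS z ?b) (R2, M1) u (R', M')"
        "u \<le> (N - Suc j) * (T + 3) + 1" "I N R' M'" "R' l = N"
      using Suc.hyps(1) by blast
    have "exec (WHILEPOS z ?b) (R, M) (1 + (t + (1 + 1)) + u) (R', M')"
      using Suc.prems Suc.hyps(2) b w(1) by (intro exec.WhileTrue) auto
    moreover have "1 + (t + (1 + 1)) + u \<le> (N - j) * (T + 3) + 1"
    proof -
      have "N - j = Suc (N - Suc j)" using j by simp
      then show ?thesis using c(2) w(2) by simp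
    qed
    ultimately show ?case using w by blast
  qed
  show ?thesis
    unfolding hoare_def
  proof (intro allI impI)
    fix R M
    assume pre: "I 0 R M \<and> R l = N"
    define R1 where "R1 = R(i := 0, z := N)"
    have "exec (CONSTANT i 0) (R, M) 1 (R(i := 0), M)" by (rule exec.Const)
    moreover have "exec (MOVE z l) (R(i := 0), M) 1 (R1, M)"
      using exec.Move[of z l "R(i := 0)" M] pre regs by (simp add: R1_def)
    moreover obtain t R' M' where w: "exec (WHILEPOS z ?b) (R1, M) t (R', M')"
        "t \<le> N * (T + 3) + 1" "I N R' M'" "R' l = N"
      using while[of 0 R1 M] frame[of 0 R M 0 N] pre regs by (auto simp: R1_def)
    ultimately have "exec (FOR z i l c) (R, M) (1 + (1 + t)) (R', M')"
      unfolding FOR_def by (intro exec.Seq)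
    moreover have "1 + (1 + t) \<le> N * (T + 3) + 3" using w(2) by simp
    ultimately show "\<exists>t R' M'. exec (FOR z i l c) (R, M) t (R', M') \<and> t \<le> N * (T + 3) + 3 \<and>
        I N R' M' \<and> R' l = N"
      using w(3,4) by blast
  qed
qed

section \<open>The program\<close>

text \<open>
  Register use: \<open>0\<close> holds \<open>n\<close>, \<open>1\<close> the base \<open>n\<^sup>2\<close> of the output, \<open>2\<close> and \<open>3\<close> the vertices \<open>a\<close> and
  \<open>b\<close>, \<open>4\<close> an entry read, \<open>5\<close> the entry to be written, \<open>6\<close> the output address, \<open>7\<close> the address of
  row \<open>a\<close> of the input, \<open>8\<close> the input address, \<open>9\<close> is scratch.
\<close>

definition decide :: "(nat \<Rightarrow> nat \<Rightarrow> bool) \<Rightarrow> (nat \<Rightarrow> nat \<Rightarrow> bool) \<Rightarrow> nat \<Rightarrow> nat \<Rightarrow> com" where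
  "decide mand forb p q =
     SEQ (if p < q then SUB 5 3 2 else if q < p then SUB 5 2 3 else CONSTANT 5 0)
       (IFPOS 5
         (if mand p q then MOVE 5 4 else if forb p q then SEQ (CONSTANT 5 1) (SUB 5 5 4)
          else CONSTANT 5 1)
         SKIP)"

text \<open>The intended matrix entry at row \<open>(p, a)\<close> and column \<open>(q, b)\<close>,
  where \<open>x\<close> is the adjacency bit of \<open>a\<close> and \<open>b\<close> in the
  input.\<close>

definition entry ::
    "(nat \<Rightarrow> nat \<Rightarrow> bool) \<Rightarrow> (nat \<Rightarrow> nat \<Rightarrow> bool) \<Rightarrow> nat \<Rightarrow> nat \<Rightarrow> nat \<Rightarrow> nat \<Rightarrow> nat \<Rightarrow> nat" where
  "entry mand forb p q a b x =
     (if p < q \<and> a < b \<or> q < p \<and> b < a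
      then if mand p q then x else if forb p q then 1 - x else 1 else 0)"

definition write_entry :: "(nat \<Rightarrow> nat \<Rightarrow> bool) \<Rightarrow> (nat \<Rightarrow> nat \<Rightarrow> bool) \<Rightarrow> nat \<Rightarrow> nat \<Rightarrow> com" where
  "write_entry mand forb p q =
     SEQ (LOAD 4 8) (SEQ (decide mand forb p q) (SEQ (STORE 6 5) (SEQ (INC 6) (INC 8))))"

text \<open>An output row \<open>(p, a)\<close> consists of one segment for each \<open>q\<close>,
  and every segment rereads row \<open>a\<close> of the input; hence register \<open>8\<close>
  restarts from \<open>7\<close>. After the last segment, \<open>8\<close> is the address of input
  row \<open>a + 1\<close>.\<close>

definition write_matrix :: "(nat \<Rightarrow> nat \<Rightarrow> bool) \<Rightarrow> (nat \<Rightarrow> nat \<Rightarrow> bool) \<Rightarrow> nat \<Rightarrow> com" where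
  "write_matrix mand forb k =
     unroll (\<lambda>p. SEQ (CONSTANT 7 0)
       (FOR 9 2 0
         (SEQ
           (unroll (\<lambda>q. SEQ (MOVE 8 7) (FOR 9 3 0 (write_entry mand forb p q))) k)
           (MOVE 7 8)))) k"

text \<open>The product \<open>n * n\<close> is obtained by counting. Register \<open>5\<close>
  saves \<open>n\<close> before register \<open>0\<close> is reset and counted up to
  \<open>k * n\<close>.\<close>

definition blowup_program :: "(nat \<Rightarrow> nat \<Rightarrow> bool) \<Rightarrow> (nat \<Rightarrow> nat \<Rightarrow> bool) \<Rightarrow> nat \<Rightarrow> com" where
  "blowup_program mand forb k =
     SEQ (FOR 9 2 0 (FOR 9 3 0 (INC 1)))
     (SEQ (MOVE 6 1)
     (SEQ (write_matrix mand forb k)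
     (SEQ (MOVE 5 0)
     (SEQ (CONSTANT 0 0) (unroll (\<lambda>_. FOR 9 2 5 (INC 0)) k)))))"

text \<open>The common invariant of all output loops: the input is intact and \<open>w\<close>
  output cells are filled. It constrains registers \<open>0\<close>, \<open>1\<close> and
  \<open>6\<close> only, which gives the frame condition of \<open>hoare_FOR\<close>.\<close>

definition written ::
    "nat \<Rightarrow> (nat \<Rightarrow> nat) \<Rightarrow> (nat \<Rightarrow> nat) \<Rightarrow> nat \<Rightarrow> (nat \<Rightarrow> nat) \<Rightarrow> (nat \<Rightarrow> nat) \<Rightarrow> bool" where
  "written n A out w R M \<longleftrightarrow> R 0 = n \<and> R 1 = n * n \<and> R 6 = n * n + w \<and>
     (\<forall>i < n * n. M i = A i) \<and> (\<forall>i < w. M (n * n + i) = out i)"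

section \<open>Correctness and running time of the program\<close>

lemma matrix_index_less:
  fixes a b m n :: nat
  assumes "a < m" and "b < n"
  shows "a * n + b < m * n"
proof -
  have "a * n + b < Suc a * n" using assms by simp
  also have "\<dots> \<le> m * n" using assms by (intro mult_le_mono1) simp
  finally show ?thesis .
qed

text \<open>Truncated subtraction serves as comparison: a difference is positive iff the strict
  inequality holds. Otherwise register \<open>5\<close> is already \<open>0\<close>, the required
  entry, so \<open>SKIP\<close> suffices. Subtraction from \<open>1\<close> negates a bit.\<close>

lemma hoare_decide:
  "hoare (\<lambda>R. Q (R(5 := entry mand forb p q (R 2) (R 3) (R 4)))) (decide mand forb p q) 6 Q"
proof -
  have move: "hoare (\<lambda>R. Q (R(5 := if mand p q then R 4 else if forb p q then 1 - R 4 else 1)))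
     (if mand p q then MOVE 5 4 else if forb p q then SEQ (CONSTANT 5 1) (SUB 5 5 4)
          else CONSTANT 5 1) 2 Q"
    using hoare_MOVE[of Q 5 4] hoare_CONSTANT[of Q 5 1]
      hoare_SEQ[OF hoare_SUB[of Q 5 5 4] hoare_CONSTANT[of _ 5 1]]
    by (auto simp: numeral_2_eq_2 elim: hoare_conseq)
  define cmp where "cmp R = (if p < q then R 3 - R 2 else if q < p then R 2 - R 3 else 0)"
    for R :: "nat \<Rightarrow> nat"
  have cmp: "hoare (\<lambda>R. S (R(5 := cmp R)))
     (if p < q then SUB 5 3 2 else if q < p then SUB 5 2 3 else CONSTANT 5 0) 1 S" for S
    using hoare_SUB[of S 5 3 2] hoare_SUB[of S 5 2 3] hoare_CONSTANT[of S 5 0]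
    by (simp add: cmp_def)
  show ?thesis
    unfolding decide_def
  proof (rule hoare_conseq, rule hoare_SEQ, rule hoare_IFPOS, rule move, rule hoare_SKIP, rule cmp)
    fix R M
    assume "Q (R(5 := entry mand forb p q (R 2) (R 3) (R 4))) M"
    then show "if 0 < (R(5 := cmp R)) 5
      then Q ((R(5 := cmp R))(5 := if mand p q then (R(5 := cmp R)) 4
             else if forb p q then 1 - (R(5 := cmp R)) 4 else 1)) M
      else Q (R(5 := cmp R)) M"
      by (cases "0 < cmp R") (auto simp: entry_def cmp_def split: if_splits)
  qed simp_all
qed

text \<open>The read address lies below \<open>n * n\<close> and the write address does not, so the
  input survives the store.\<close>

lemma hoare_write_entry:
  assumes "out w = entry mand forb p q a b (A i)" and "i < n * n"
  shows "hoare (\<lambda>R M. written n A out w R M \<and> R 2 = a \<and> R 3 = b \<and> R 7 = c \<and> R 8 = i)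
     (write_entry mand forb p q) 10
     (\<lambda>R M. written n A out (Suc w) R M \<and> R 2 = a \<and> R 3 = b \<and> R 7 = c \<and> R 8 = Suc i)"
  unfolding write_entry_def
  by (rule hoare_strengthen_pre, (rule hoare_SEQ hoare_LOAD hoare_decide hoare_STORE hoare_INC)+)
    (use assms in \<open>simp_all add: written_def less_Suc_eq\<close>)

lemma hoare_square:
  "hoare (\<lambda>R M. R 0 = n \<and> R 1 = 0 \<and> (\<forall>i < n * n. M i = A i)) (FOR 9 2 0 (FOR 9 3 0 (INC 1)))
     (n * (n * 4 + 6) + 3)
     (\<lambda>R M. R 0 = n \<and> R 1 = n * n \<and> (\<forall>i < n * n. M i = A i))"
proof -
  let ?J = "\<lambda>a b R M. R 1 = a * n + b \<and> R 2 = a \<and> (\<forall>i < n * n. M i = A i)"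
  let ?I = "\<lambda>a R M. R 1 = a * n \<and> (\<forall>i < n * n. M i = A i)"
  have inner: "hoare (\<lambda>R M. ?J a 0 R M \<and> R 0 = n) (FOR 9 3 0 (INC 1)) (n * (1 + 3) + 3)
      (\<lambda>R M. ?J a n R M \<and> R 0 = n)" for a
  proof (rule hoare_FOR)
    fix b
    show "hoare (\<lambda>R M. ?J a b R M \<and> R 3 = b \<and> R 0 = n) (INC 1) 1
        (\<lambda>R M. ?J a (Suc b) R M \<and> R 3 = b \<and> R 0 = n)"
      by (rule hoare_strengthen_pre, rule hoare_INC) auto
  qed auto
  have "hoare (\<lambda>R M. ?I 0 R M \<and> R 0 = n) (FOR 9 2 0 (FOR 9 3 0 (INC 1)))
      (n * ((n * (1 + 3) + 3) + 3) + 3) (\<lambda>R M. ?I n R M \<and> R 0 = n)"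
  proof (rule hoare_FOR)
    fix a
    show "hoare (\<lambda>R M. ?I a R M \<and> R 2 = a \<and> R 0 = n) (FOR 9 3 0 (INC 1)) (n * (1 + 3) + 3)
        (\<lambda>R M. ?I (Suc a) R M \<and> R 2 = a \<and> R 0 = n)"
      using inner[of a] by (rule hoare_conseq) auto
  qed auto
  then show ?thesis by (rule hoare_conseq) (auto simp: algebra_simps)
qed

text \<open>\<open>Z\<close> stands for whatever is known about the memory and the output base. The
  loops change only registers \<open>0\<close>, \<open>2\<close> and \<open>9\<close>, so it is
  preserved.\<close>

lemma hoare_set_size:
  fixes Z :: "nat \<Rightarrow> (nat \<Rightarrow> nat) \<Rightarrow> bool"
  shows "hoare (\<lambda>R M. R 0 = 0 \<and> R 5 = n \<and> Z (R 1) M) (unroll (\<lambda>_. FOR 9 2 5 (INC 0)) k)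
     (k * (n * 4 + 3) + 1) (\<lambda>R M. R 0 = k * n \<and> R 5 = n \<and> Z (R 1) M)"
proof -
  let ?I = "\<lambda>j R M. R 0 = j * n \<and> R 5 = n \<and> Z (R 1) M"
  have "hoare (?I 0) (unroll (\<lambda>_. FOR 9 2 5 (INC 0)) k) (k * (n * 4 + 3) + 1) (?I k)"
  proof (rule hoare_unroll)
    fix j
    let ?J = "\<lambda>a R M. R 0 = j * n + a \<and> Z (R 1) M"
    have "hoare (\<lambda>R M. ?J 0 R M \<and> R 5 = n) (FOR 9 2 5 (INC 0)) (n * (1 + 3) + 3)
        (\<lambda>R M. ?J n R M \<and> R 5 = n)"
    proof (rule hoare_FOR)
      fix a
      show "hoare (\<lambda>R M. ?J a R M \<and> R 2 = a \<and> R 5 = n) (INC 0) 1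
          (\<lambda>R M. ?J (Suc a) R M \<and> R 2 = a \<and> R 5 = n)"
        by (rule hoare_strengthen_pre, rule hoare_INC) auto
    qed auto
    then show "hoare (?I j) (FOR 9 2 5 (INC 0)) (n * 4 + 3) (?I (Suc j))"
      by (rule hoare_conseq) auto
  qed
  then show ?thesis by simp
qed

text \<open>The index in \<open>out\<close> is the Horner form of the row-major address of row
  \<open>p * n + a\<close> and column \<open>q * n + b\<close> in a matrix of width
  \<open>k * n\<close>. It grows by one with each entry written.\<close>

context
  fixes mand forb :: "nat \<Rightarrow> nat \<Rightarrow> bool" and k n :: nat and A out :: "nat \<Rightarrow> nat"
  assumes out: "\<And>p a q b. p < k \<Longrightarrow> a < n \<Longrightarrow> q < k \<Longrightarrow> b < n \<Longrightarrow>
    out (((p * n + a) * k + q) * n + b) = entry mand forb p q a b (A (a * n + b))"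
begin

lemma hoare_write_segment:
  assumes "p < k" and "a < n" and "q < k" and w: "w = ((p * n + a) * k + q) * n"
  shows "hoare (\<lambda>R M. written n A out w R M \<and> R 2 = a \<and> R 7 = a * n)
     (SEQ (MOVE 8 7) (FOR 9 3 0 (write_entry mand forb p q))) (n * 13 + 4)
     (\<lambda>R M. written n A out (w + n) R M \<and> R 2 = a \<and> R 7 = a * n \<and> R 8 = a * n + n)"
proof -
  let ?I = "\<lambda>b R M. written n A out (w + b) R M \<and> R 2 = a \<and> R 7 = a * n \<and> R 8 = a * n + b"
  have "hoare (\<lambda>R M. ?I 0 R M \<and> R 0 = n) (FOR 9 3 0 (write_entry mand forb p q))
      (n * (10 + 3) + 3) (\<lambda>R M. ?I n R M \<and> R 0 = n)"
  proof (rule hoare_FOR)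
    fix b
    assume b: "b < n"
    show "hoare (\<lambda>R M. ?I b R M \<and> R 3 = b \<and> R 0 = n) (write_entry mand forb p q) 10
        (\<lambda>R M. ?I (Suc b) R M \<and> R 3 = b \<and> R 0 = n)"
      by (rule hoare_conseq, rule hoare_write_entry[of out "w + b" mand forb p q a b A "a * n + b" n "a * n"])
        (use assms b out[of p a q b] in \<open>auto simp: written_def intro: matrix_index_less\<close>)
  qed (auto simp: written_def)
  moreover have "hoare (\<lambda>R M. written n A out w R M \<and> R 2 = a \<and> R 7 = a * n) (MOVE 8 7) 1
      (\<lambda>R M. ?I 0 R M \<and> R 0 = n)"
    by (rule hoare_strengthen_pre, rule hoare_MOVE) (auto simp: written_def)
  ultimately have "hoare (\<lambda>R M. written n A out w R M \<and> R 2 = a \<and> R 7 = a * n)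
     (SEQ (MOVE 8 7) (FOR 9 3 0 (write_entry mand forb p q))) (1 + (n * (10 + 3) + 3))
     (\<lambda>R M. ?I n R M \<and> R 0 = n)"
    by (rule hoare_SEQ)
  then show ?thesis by (rule hoare_conseq) auto
qed

lemma hoare_write_row:
  assumes p: "p < k" and a: "a < n" and w: "w = (p * n + a) * k * n"
  shows "hoare (\<lambda>R M. written n A out w R M \<and> R 2 = a \<and> R 7 = a * n)
     (SEQ (unroll (\<lambda>q. SEQ (MOVE 8 7) (FOR 9 3 0 (write_entry mand forb p q))) k) (MOVE 7 8))
     (k * (n * 13 + 4) + 2)
     (\<lambda>R M. written n A out (w + k * n) R M \<and> R 2 = a \<and> R 7 = a * n + n)"
proof -
  \<comment> \<open>Register \<open>8\<close> is meaningful only after the first segment. As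
    \<open>p < k\<close> forces \<open>0 < k\<close>, the guard is discharged at the end of the
    row.\<close>
  let ?I = "\<lambda>q R M. written n A out (w + q * n) R M \<and> R 2 = a \<and> R 7 = a * n \<and>
    (0 < q \<longrightarrow> R 8 = a * n + n)"
  have "hoare (?I 0) (unroll (\<lambda>q. SEQ (MOVE 8 7) (FOR 9 3 0 (write_entry mand forb p q))) k)
      (k * (n * 13 + 4) + 1) (?I k)"
  proof (rule hoare_unroll)
    fix q
    assume q: "q < k"
    show "hoare (?I q) (SEQ (MOVE 8 7) (FOR 9 3 0 (write_entry mand forb p q))) (n * 13 + 4)
        (?I (Suc q))"
      by (rule hoare_conseq, rule hoare_write_segment[OF p a q, of "w + q * n"])
        (auto simp: w algebra_simps)
  qed
  moreover have "hoare (?I k) (MOVE 7 8) 1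
      (\<lambda>R M. written n A out (w + k * n) R M \<and> R 2 = a \<and> R 7 = a * n + n)"
    by (rule hoare_strengthen_pre, rule hoare_MOVE) (use p in \<open>auto simp: written_def\<close>)
  ultimately have "hoare (?I 0)
      (SEQ (unroll (\<lambda>q. SEQ (MOVE 8 7) (FOR 9 3 0 (write_entry mand forb p q))) k) (MOVE 7 8))
      ((k * (n * 13 + 4) + 1) + 1)
      (\<lambda>R M. written n A out (w + k * n) R M \<and> R 2 = a \<and> R 7 = a * n + n)"
    by (intro hoare_SEQ)
  then show ?thesis by (rule hoare_conseq) auto
qed

lemma hoare_write_block:
  assumes p: "p < k" and w: "w = p * n * k * n"
  shows "hoare (written n A out w)
     (SEQ (CONSTANT 7 0)
       (FOR 9 2 0
         (SEQ (unroll (\<lambda>q. SEQ (MOVE 8 7) (FOR 9 3 0 (write_entry mand forb p q))) k) (MOVE 7 8))))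
     (n * (k * (n * 13 + 4) + 5) + 4)
     (written n A out (w + n * k * n))"
    (is "hoare _ (SEQ _ (FOR 9 2 0 ?row)) _ _")
proof -
  let ?I = "\<lambda>a R M. written n A out (w + a * k * n) R M \<and> R 7 = a * n"
  have "hoare (\<lambda>R M. ?I 0 R M \<and> R 0 = n) (FOR 9 2 0 ?row)
      (n * ((k * (n * 13 + 4) + 2) + 3) + 3) (\<lambda>R M. ?I n R M \<and> R 0 = n)"
  proof (rule hoare_FOR)
    fix a
    assume a: "a < n"
    show "hoare (\<lambda>R M. ?I a R M \<and> R 2 = a \<and> R 0 = n) ?row (k * (n * 13 + 4) + 2)
        (\<lambda>R M. ?I (Suc a) R M \<and> R 2 = a \<and> R 0 = n)"
      by (rule hoare_conseq, rule hoare_write_row[OF p a, of "w + a * k * n"])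
        (auto simp: w written_def algebra_simps)
  qed (auto simp: written_def)
  moreover have "hoare (written n A out w) (CONSTANT 7 0) 1 (\<lambda>R M. ?I 0 R M \<and> R 0 = n)"
    by (rule hoare_strengthen_pre, rule hoare_CONSTANT) (auto simp: written_def)
  ultimately have "hoare (written n A out w) (SEQ (CONSTANT 7 0) (FOR 9 2 0 ?row))
      (1 + (n * ((k * (n * 13 + 4) + 2) + 3) + 3)) (\<lambda>R M. ?I n R M \<and> R 0 = n)"
    by (rule hoare_SEQ)
  then show ?thesis by (rule hoare_conseq) auto
qed

lemma hoare_write_matrix:
  "hoare (written n A out 0) (write_matrix mand forb k)
     (k * (n * (k * (n * 13 + 4) + 5) + 4) + 1)
     (written n A out (k * n * k * n))"
proof -
  let ?I = "\<lambda>p. written n A out (p * n * k * n)"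
  have "hoare (?I 0) (write_matrix mand forb k)
      (k * (n * (k * (n * 13 + 4) + 5) + 4) + 1) (?I k)"
    unfolding write_matrix_def
  proof (rule hoare_unroll)
    fix p
    assume "p < k"
    from hoare_write_block[OF this refl]
    show "hoare (?I p)
       (SEQ (CONSTANT 7 0)
         (FOR 9 2 0
           (SEQ (unroll (\<lambda>q. SEQ (MOVE 8 7) (FOR 9 3 0 (write_entry mand forb p q))) k)
             (MOVE 7 8))))
       (n * (k * (n * 13 + 4) + 5) + 4) (?I (Suc p))"
      by (rule hoare_conseq) (auto simp: algebra_simps)
  qed
  then show ?thesis by simp
qed

lemma hoare_blowup_program:
  "hoare (\<lambda>R M. R 0 = n \<and> R 1 = 0 \<and> (\<forall>i < n * n. M i = A i)) (blowup_program mand forb k)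
     ((17 * k\<^sup>2 + 16 * k + 18) * (n\<^sup>2 + 1))
     (\<lambda>R M. R 0 = k * n \<and> (\<forall>i < k * n * k * n. M (R 1 + i) = out i))"
proof -
  let ?Z = "\<lambda>b M. \<forall>i < k * n * k * n. M (b + i) = out i"
  have "hoare (\<lambda>R M. R 0 = n \<and> R 1 = 0 \<and> (\<forall>i < n * n. M i = A i)) (blowup_program mand forb k)
     ((n * (n * 4 + 6) + 3) + (1 + ((k * (n * (k * (n * 13 + 4) + 5) + 4) + 1) +
       (1 + (1 + (k * (n * 4 + 3) + 1))))))
     (\<lambda>R M. R 0 = k * n \<and> R 5 = n \<and> ?Z (R 1) M)"
    unfolding blowup_program_def
  \<comment> \<open>The triples for squaring and for the matrix fix the assertions around them; the
    tail is processed backwards from the final postcondition.\<close>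
  proof (rule hoare_SEQ[OF _ hoare_square], rule hoare_SEQ, rule hoare_SEQ[OF _ hoare_write_matrix],
      rule hoare_SEQ, rule hoare_SEQ, rule hoare_set_size, rule hoare_CONSTANT)
    show "hoare (written n A out (k * n * k * n)) (MOVE 5 0) 1
        (\<lambda>R M. (R(0 := 0)) 0 = 0 \<and> (R(0 := 0)) 5 = n \<and> ?Z ((R(0 := 0)) 1) M)"
      by (rule hoare_strengthen_pre, rule hoare_MOVE) (auto simp: written_def)
    show "hoare (\<lambda>R M. R 0 = n \<and> R 1 = n * n \<and> (\<forall>i < n * n. M i = A i)) (MOVE 6 1) 1
        (written n A out 0)"
      by (rule hoare_strengthen_pre, rule hoare_MOVE) (auto simp: written_def)
  qed
  then show ?thesis
  proof (rule hoare_conseq)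
    \<comment> \<open>Both \<open>n\<close> and \<open>1\<close> are absorbed by
      \<open>n\<^sup>2 + 1\<close>, so the final factor is the sum of the coefficients of the
      quadratic, linear and constant terms.\<close>
    have lin: "n \<le> n\<^sup>2" by (cases n) (auto simp: power2_eq_square)
    have "(n * (n * 4 + 6) + 3) + (1 + ((k * (n * (k * (n * 13 + 4) + 5) + 4) + 1) +
       (1 + (1 + (k * (n * 4 + 3) + 1))))) =
      (13 * k\<^sup>2 + 4) * n\<^sup>2 + (4 * k\<^sup>2 + 9 * k + 6) * n + (7 * k + 8)"
      by (simp add: algebra_simps power2_eq_square)
    also have "\<dots> \<le> (13 * k\<^sup>2 + 4) * n\<^sup>2 + (4 * k\<^sup>2 + 9 * k + 6) * n\<^sup>2 + (7 * k + 8)"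
      using lin by simp
    also have "\<dots> \<le> (17 * k\<^sup>2 + 16 * k + 18) * (n\<^sup>2 + 1)"
      by (simp add: algebra_simps)
    finally show "(n * (n * 4 + 6) + 3) + (1 + ((k * (n * (k * (n * 13 + 4) + 5) + 4) + 1) +
       (1 + (1 + (k * (n * 4 + 3) + 1))))) \<le> (17 * k\<^sup>2 + 16 * k + 18) * (n\<^sup>2 + 1)" .
  qed auto
qed

end

section \<open>Increasing enumerations\<close>

text \<open>Insertion sort. The carrier \<open>A\<close> is kept apart from \<open>V\<close> so that
  the order stays fixed while \<open>V\<close> grows in the induction.\<close>

lemma exists_sorted_list:
  assumes "finite V" and "linear_order_on A r" and "V \<subseteq> A"
  shows "\<exists>vs. enumerates vs V \<and> sorted_wrt (\<lambda>u v. (u, v) \<in> r) vs"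
  using assms(1,3)
proof (induction V)
  case empty
  show ?case by (intro exI[of _ "[]"]) (simp add: enumerates_def)
next
  case (insert x V)
  then obtain vs where vs: "distinct vs" "set vs = V" "sorted_wrt (\<lambda>u v. (u, v) \<in> r) vs"
    by (auto simp: enumerates_def)
  have "trans r" "total_on A r" using assms(2) by (auto simp: order_on_defs)
  let ?below = "filter (\<lambda>y. (y, x) \<in> r) vs" and ?above = "filter (\<lambda>y. (y, x) \<notin> r) vs"
  have above: "(x, y) \<in> r" if "y \<in> set ?above" for y
    using that insert.hyps insert.prems vs \<open>total_on A r\<close> by (auto simp: total_on_def)
  have "sorted_wrt (\<lambda>u v. (u, v) \<in> r) (?below @ x # ?above)"
    using vs(3) above \<open>trans r\<close>
    by (auto simp: sorted_wrt_append sorted_wrt_filter dest: transD)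
  moreover have "enumerates (?below @ x # ?above) (insert x V)"
    using vs insert.hyps by (auto simp: enumerates_def)
  ultimately show ?case by blast
qed

text \<open>Each head lies below all other elements of its list, so by antisymmetry the heads agree.
  This makes the reduction independent of a chosen enumeration.\<close>

lemma sorted_list_unique:
  assumes "antisym r" and "set vs = set ws" and "distinct vs" and "distinct ws"
    and "sorted_wrt (\<lambda>u v. (u, v) \<in> r) vs" and "sorted_wrt (\<lambda>u v. (u, v) \<in> r) ws"
  shows "vs = ws"
  using assms(2-)
proof (induction vs arbitrary: ws)
  case Nil
  then show ?case by simp
next
  case (Cons v vs)
  then obtain w ws' where ws: "ws = w # ws'" by (cases ws) auto
  have "v = w"
  proof (rule ccontr)
    assume "v \<noteq> w"
    then have "w \<in> set vs" "v \<in> set ws'" using Cons.prems(1) ws by auto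
    then have "(v, w) \<in> r" "(w, v) \<in> r" using Cons.prems(4,5) ws by auto
    then show False using \<open>v \<noteq> w\<close> assms(1) by (auto dest: antisymD)
  qed
  moreover have "vs = ws'"
  proof (rule Cons.IH)
    show "set vs = set ws'" using Cons.prems(1-3) ws \<open>v = w\<close> by auto
  qed (use Cons.prems ws in auto)
  ultimately show ?case using ws by simp
qed

text \<open>Translates the given orders into the order of indices, so that the combinatorics can be
  done with natural numbers.\<close>

lemma nth_order_iff:
  assumes "linear_order_on (set vs) r" and "distinct vs" and "sorted_wrt (\<lambda>u v. (u, v) \<in> r) vs"
    and "a < length vs" and "b < length vs"
  shows "(vs ! a, vs ! b) \<in> r \<longleftrightarrow> a \<le> b"
proof
  assume le: "(vs ! a, vs ! b) \<in> r"
  show "a \<le> b"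
  proof (rule ccontr)
    assume "\<not> a \<le> b"
    then have "(vs ! b, vs ! a) \<in> r" using assms by (simp add: sorted_wrt_iff_nth_less)
    with le have "vs ! a = vs ! b" using assms(1) by (auto simp: order_on_defs dest: antisymD)
    then show False using assms \<open>\<not> a \<le> b\<close> by (simp add: nth_eq_iff_index_eq)
  qed
next
  assume "a \<le> b"
  then show "(vs ! a, vs ! b) \<in> r"
    using assms by (cases "a = b") (auto simp: sorted_wrt_iff_nth_less order_on_defs refl_on_def)
qed

section \<open>The clique graph\<close>

lemma matrix_index_eq_iff:
  fixes a b n :: nat
  assumes "a < n" and "b < n"
  shows "p * n + a = q * n + b \<longleftrightarrow> p = q \<and> a = b"
proof
  assume eq: "p * n + a = q * n + b"
  have "p = (p * n + a) div n" "a = (p * n + a) mod n" using assms by auto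
  moreover have "q = (q * n + b) div n" "b = (q * n + b) mod n" using assms by auto
  ultimately show "p = q \<and> a = b" using eq by metis
qed simp

text \<open>All four arguments are indices, and the notion is meant for \<open>p < q\<close>.
  Undecided pairs constrain nothing beyond \<open>a < b\<close>.\<close>

definition compatible ::
    "'p pattern \<Rightarrow> 'p list \<Rightarrow> 'a ordered_graph \<Rightarrow> 'a list \<Rightarrow> nat \<Rightarrow> nat \<Rightarrow> nat \<Rightarrow> nat \<Rightarrow> bool" where
  "compatible P ps G vs p q a b \<longleftrightarrow> a < b \<and>
     ({ps ! p, ps ! q} \<in> mandatory P \<longrightarrow> {vs ! a, vs ! b} \<in> edges G) \<and>
     ({ps ! p, ps ! q} \<in> forbidden P \<longrightarrow> {vs ! a, vs ! b} \<notin> edges G)"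

text \<open>An occurrence of the pattern as an index function. It mediates between cliques and
  pattern containment, which are both shown equivalent to its existence.\<close>

definition pairwise_compatible ::
    "'p pattern \<Rightarrow> 'p list \<Rightarrow> 'a ordered_graph \<Rightarrow> 'a list \<Rightarrow> (nat \<Rightarrow> nat) \<Rightarrow> bool" where
  "pairwise_compatible P ps G vs g \<longleftrightarrow> (\<forall>p < length ps. g p < length vs) \<and>
     (\<forall>p q. p < q \<and> q < length ps \<longrightarrow> compatible P ps G vs p q (g p) (g q))"

text \<open>
  The vertex \<open>p * n + a\<close> stands for the choice of the \<open>a\<close>-th vertex of \<open>G\<close> as the image of the
  \<open>p\<close>-th vertex of \<open>P\<close>.
\<close>

definition blowup :: "'p pattern \<Rightarrow> 'p list \<Rightarrow> 'a ordered_graph \<Rightarrow> 'a list \<Rightarrow> nat graph" where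
  "blowup P ps G vs = \<lparr>
     verts = {..<length ps * length vs},
     edges = {{p * length vs + a, q * length vs + b} | p q a b.
       p < q \<and> q < length ps \<and> a < length vs \<and> b < length vs \<and> compatible P ps G vs p q a b}\<rparr>"

lemma simple_graph_blowup: "simple_graph (blowup P ps G vs)"
  by (auto simp: simple_graph_def blowup_def matrix_index_less matrix_index_eq_iff)

lemma blowup_edge_iff:
  assumes "p < length ps" and "q < length ps" and "a < length vs" and "b < length vs"
  shows "{p * length vs + a, q * length vs + b} \<in> edges (blowup P ps G vs) \<longleftrightarrow>
    p < q \<and> compatible P ps G vs p q a b \<or> q < p \<and> compatible P ps G vs q p b a"
    (is "?e \<in> _ \<longleftrightarrow> ?R")
proof
  assume "?e \<in> edges (blowup P ps G vs)"
  then obtain p' q' a' b' where *: "?e = {p' * length vs + a', q' * length vs + b'}"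
      "p' < q'" "a' < length vs" "b' < length vs" "compatible P ps G vs p' q' a' b'"
    by (auto simp: blowup_def)
  from *(1) have "p = p' \<and> a = a' \<and> q = q' \<and> b = b' \<or> p = q' \<and> a = b' \<and> q = p' \<and> b = a'"
    using assms(3,4) *(3,4) by (auto simp: doubleton_eq_iff matrix_index_eq_iff)
  with * show ?R by auto
next
  assume ?R
  then show "?e \<in> edges (blowup P ps G vs)"
  proof
    assume "p < q \<and> compatible P ps G vs p q a b"
    then show ?thesis using assms by (auto simp: blowup_def)
  next
    assume "q < p \<and> compatible P ps G vs q p b a"
    then have "{q * length vs + b, p * length vs + a} \<in> edges (blowup P ps G vs)"
      using assms by (auto simp: blowup_def)
    then show ?thesis by (simp add: insert_commute)
  qed
qed

text \<open>\<open>entry\<close> tests mandatory before forbidden, whereas \<open>compatible\<close>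
  imposes both conditions; disjointness reconciles the two.\<close>

lemma adj_bit_blowup:
  assumes "p < length ps" and "q < length ps" and "a < length vs" and "b < length vs"
    and "mandatory P \<inter> forbidden P = {}"
  shows "adj_bit (blowup P ps G vs) (p * length vs + a) (q * length vs + b) =
    entry (\<lambda>p q. {ps ! p, ps ! q} \<in> mandatory P) (\<lambda>p q. {ps ! p, ps ! q} \<in> forbidden P) p q a b
      (adj_bit G (vs ! a) (vs ! b))"
proof -
  have "{ps ! q, ps ! p} = {ps ! p, ps ! q}" "{vs ! b, vs ! a} = {vs ! a, vs ! b}"
    by auto
  then show ?thesis
    unfolding adj_bit_def[of "blowup P ps G vs"] blowup_edge_iff[OF assms(1-4)]
    using assms(5) by (auto simp: adj_bit_def entry_def compatible_def)
qed

section \<open>Running the program on an input\<close>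

lemma blowup_computable:
  assumes "mandatory P \<inter> forbidden P = {}"
  shows "\<exists>c C. \<forall>(G :: 'a ordered_graph) vs. \<exists>t s. exec c (input_state G vs) t s \<and>
    output_state s (blowup P ps G vs) \<and> t \<le> C * ((length vs)\<^sup>2 + 1)"
\<comment> \<open>The witnesses stay schematic until the last \<open>show\<close>; they are built
  from \<open>P\<close> and \<open>ps\<close> and cannot depend on \<open>G\<close> or
  \<open>vs\<close>.\<close>
proof (rule exI, rule exI, intro allI)
  fix G :: "'a ordered_graph" and vs :: "'a list"
  define k where "k = length ps"
  define n where "n = length vs"
  define H where "H = blowup P ps G vs"
  let ?mand = "\<lambda>p q. {ps ! p, ps ! q} \<in> mandatory P"
  let ?forb = "\<lambda>p q. {ps ! p, ps ! q} \<in> forbidden P"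
  define A where "A i = adj_bit G (vs ! (i div n)) (vs ! (i mod n))" for i
  define out where "out i = adj_bit H (i div (k * n)) (i mod (k * n))" for i
  have out_index: "out (i * (k * n) + j) = adj_bit H i j" if "j < k * n" for i j
  proof -
    have "(i * m + j) div m = i \<and> (i * m + j) mod m = j" if "j < m" for m
      using that by simp
    from this[OF that] show ?thesis by (simp add: out_def)
  qed
  have "out (((p * n + a) * k + q) * n + b) = entry ?mand ?forb p q a b (A (a * n + b))"
    if "p < k" "a < n" "q < k" "b < n" for p a q b
  proof -
    have "((p * n + a) * k + q) * n + b = (p * n + a) * (k * n) + (q * n + b)"
      by (simp add: algebra_simps)
    moreover have "q * n + b < k * n" using that by (intro matrix_index_less)
    ultimately have "out (((p * n + a) * k + q) * n + b) = adj_bit H (p * n + a) (q * n + b)"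
      using out_index by metis
    also have "\<dots> = entry ?mand ?forb p q a b (adj_bit G (vs ! a) (vs ! b))"
      using adj_bit_blowup[of p ps q a vs b P G] that assms by (simp add: H_def k_def n_def)
    finally show ?thesis using that by (simp add: A_def)
  qed
  then have run: "hoare (\<lambda>R M. R 0 = n \<and> R 1 = 0 \<and> (\<forall>i < n * n. M i = A i))
     (blowup_program ?mand ?forb k) ((17 * k\<^sup>2 + 16 * k + 18) * (n\<^sup>2 + 1))
     (\<lambda>R M. R 0 = k * n \<and> (\<forall>i < k * n * k * n. M (R 1 + i) = out i))"
    by (rule hoare_blowup_program)
  obtain R M where RM: "input_state G vs = (R, M)" by (cases "input_state G vs")
  then have input: "R 0 = n \<and> R 1 = 0 \<and> (\<forall>i < n * n. M i = A i)"
    by (auto simp: input_state_def Let_def n_def A_def)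
  obtain t R' M' where
    exec: "exec (blowup_program ?mand ?forb k) (R, M) t (R', M')"
      "t \<le> (17 * k\<^sup>2 + 16 * k + 18) * (n\<^sup>2 + 1)"
    and post: "R' 0 = k * n \<and> (\<forall>i < k * n * k * n. M' (R' 1 + i) = out i)"
    by (rule hoareE[where R = R and M = M, OF run input])
  have "output_state (R', M') H"
    unfolding output_state_def
  proof (intro exI conjI allI impI)
    show "enumerates [0..<k * n] (verts H)"
      by (auto simp: enumerates_def H_def blowup_def k_def n_def)
    show "fst (R', M') 0 = length [0..<k * n]" using post by simp
    fix i j
    assume "i < length [0..<k * n]" and "j < length [0..<k * n]"
    then have ij: "i < k * n" "j < k * n" by auto
    then have "i * (k * n) + j < k * n * (k * n)" by (intro matrix_index_less)
    then have "M' (R' 1 + (i * (k * n) + j)) = out (i * (k * n) + j)"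
      using post by (simp add: mult.assoc)
    then show "snd (R', M') (fst (R', M') 1 + i * length [0..<k * n] + j) =
        adj_bit H ([0..<k * n] ! i) ([0..<k * n] ! j)"
      using out_index ij by (simp add: add.assoc)
  qed
  with exec show "\<exists>t s. exec (blowup_program ?mand ?forb (length ps)) (input_state G vs) t s \<and>
      output_state s (blowup P ps G vs) \<and>
      t \<le> (17 * (length ps)\<^sup>2 + 16 * length ps + 18) * ((length vs)\<^sup>2 + 1)"
    unfolding H_def k_def n_def RM by blast
qed

section \<open>Cliques and occurrences as index functions\<close>

lemma contains_clique_iff_compatible:
  "contains_clique (blowup P ps G vs) (length ps) \<longleftrightarrow>
    (\<exists>g. pairwise_compatible P ps G vs g)"
    (is "contains_clique ?H ?k \<longleftrightarrow> _")
proof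
  let ?n = "length vs"
  assume "contains_clique ?H ?k"
  then obtain K where K: "K \<subseteq> {..<?k * ?n}" "card K = ?k" "clique K (edges ?H)"
    by (auto simp: contains_clique_def blowup_def)
  have coords: "v div ?n < ?k" "v mod ?n < ?n" "v = v div ?n * ?n + v mod ?n" if "v \<in> K" for v
  proof -
    have "v < ?k * ?n" using that K(1) by auto
    \<comment> \<open>Division by \<open>?n\<close> is safe here: an empty \<open>vs\<close> would
      leave no vertex for \<open>v\<close>.\<close>
    moreover from this have "0 < ?n" by (cases "?n = 0") auto
    ultimately show "v div ?n < ?k" "v mod ?n < ?n" "v = v div ?n * ?n + v mod ?n"
      by (auto simp: less_mult_imp_div_less)
  qed
  have adjacent: "v div ?n < w div ?n \<and> compatible P ps G vs (v div ?n) (w div ?n) (v mod ?n) (w mod ?n)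
      \<or> w div ?n < v div ?n \<and> compatible P ps G vs (w div ?n) (v div ?n) (w mod ?n) (v mod ?n)"
    if "v \<in> K" "w \<in> K" "v \<noteq> w" for v w
  proof -
    have "{v, w} \<in> edges ?H" using K(3) that by (auto simp: clique_def)
    then show ?thesis
      using blowup_edge_iff[of "v div ?n" ps "w div ?n" "v mod ?n" vs "w mod ?n" P G]
        coords[OF that(1)] coords[OF that(2)] by simp
  qed
  have inj: "inj_on (\<lambda>v. v div ?n) K"
  proof (rule inj_onI)
    fix v w
    assume "v \<in> K" "w \<in> K" "v div ?n = w div ?n"
    then show "v = w" using adjacent[of v w] by auto
  qed
  \<comment> \<open>Pigeonhole: an injective map from \<open>?k\<close> clique vertices into
    \<open>?k\<close> positions hits every position.\<close>
  have "(\<lambda>v. v div ?n) ` K = {..<?k}"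
  proof (rule card_subset_eq)
    show "(\<lambda>v. v div ?n) ` K \<subseteq> {..<?k}" using coords by auto
    show "card ((\<lambda>v. v div ?n) ` K) = card {..<?k}" using card_image[OF inj] K(2) by simp
  qed simp
  then have "\<exists>v \<in> K. v div ?n = p" if "p < ?k" for p
    using that by (metis imageE lessThan_iff)
  then obtain h where h: "\<And>p. p < ?k \<Longrightarrow> h p \<in> K \<and> h p div ?n = p" by metis
  have "pairwise_compatible P ps G vs (\<lambda>p. h p mod ?n)"
    unfolding pairwise_compatible_def
  proof (intro conjI allI impI)
    show "h p mod ?n < ?n" if "p < ?k" for p using coords h that by blast
    fix p q
    assume "p < q \<and> q < ?k"
    moreover from this have "p < ?k" by simp
    ultimately show "compatible P ps G vs p q (h p mod ?n) (h q mod ?n)"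
      using adjacent[of "h p" "h q"] h[of p] h[of q] by fastforce
  qed
  then show "\<exists>g. pairwise_compatible P ps G vs g" by blast
next
  let ?n = "length vs"
  assume "\<exists>g. pairwise_compatible P ps G vs g"
  then obtain g where "pairwise_compatible P ps G vs g" by blast
  then have g: "\<And>p. p < ?k \<Longrightarrow> g p < ?n"
    and compat: "\<And>p q. p < q \<Longrightarrow> q < ?k \<Longrightarrow> compatible P ps G vs p q (g p) (g q)"
    by (auto simp: pairwise_compatible_def)
  let ?K = "(\<lambda>p. p * ?n + g p) ` {..<?k}"
  have "inj_on (\<lambda>p. p * ?n + g p) {..<?k}"
    using g by (auto simp: inj_on_def matrix_index_eq_iff)
  then have "card ?K = ?k" by (simp add: card_image)
  moreover have "?K \<subseteq> verts ?H"
    using g by (auto simp: blowup_def intro: matrix_index_less)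
  moreover have "clique ?K (edges ?H)"
    unfolding clique_def
  proof (intro ballI impI)
    fix v w
    assume "v \<in> ?K" "w \<in> ?K" "v \<noteq> w"
    then obtain p q where "p < ?k" "q < ?k" "p \<noteq> q" "v = p * ?n + g p" "w = q * ?n + g q"
      by auto
    then show "{v, w} \<in> edges ?H"
      using blowup_edge_iff[of p ps q "g p" vs "g q" P G] g compat[of p q] compat[of q p]
      by (cases p q rule: linorder_cases) simp_all
  qed
  ultimately show "contains_clique ?H ?k" unfolding contains_clique_def by blast
qed

context
  fixes P :: "'p pattern" and ps :: "'p list" and G :: "'a ordered_graph" and vs :: "'a list"
  assumes P: "is_pattern P" "enumerates ps (pverts P)" "sorted_wrt (\<lambda>p q. (p, q) \<in> pord P) ps"
    and G: "is_ordered_graph G" "enumerates vs (verts G)" "sorted_wrt (\<lambda>u v. (u, v) \<in> vord G) vs"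
begin

lemma pord_nth_iff:
  "p < length ps \<Longrightarrow> q < length ps \<Longrightarrow> (ps ! p, ps ! q) \<in> pord P \<longleftrightarrow> p \<le> q"
  using P by (intro nth_order_iff) (auto simp: is_pattern_def enumerates_def)

lemma vord_nth_iff:
  "a < length vs \<Longrightarrow> b < length vs \<Longrightarrow> (vs ! a, vs ! b) \<in> vord G \<longleftrightarrow> a \<le> b"
  using G by (intro nth_order_iff) (auto simp: is_ordered_graph_def enumerates_def)

text \<open>An embedding \<open>f\<close> and an index function \<open>g\<close> determine each
  other through \<open>vs ! g p = f (ps ! p)\<close>.\<close>

lemma contains_pattern_iff_compatible:
  "contains_pattern G P \<longleftrightarrow>
    (\<exists>g. pairwise_compatible P ps G vs g)"
proof
  have ps: "distinct ps" "set ps = pverts P" and vs: "set vs = verts G"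
    using P(2) G(2) by (auto simp: enumerates_def)
  assume "contains_pattern G P"
  then obtain X f where "X \<subseteq> verts G \<and> bij_betw f (pverts P) X \<and>
      (\<forall>x\<in>pverts P. \<forall>y\<in>pverts P. (x, y) \<in> pord P \<longleftrightarrow> (f x, f y) \<in> vord G) \<and>
      (\<forall>e\<in>mandatory P. f ` e \<in> edges G) \<and> (\<forall>e\<in>forbidden P. f ` e \<notin> edges G)"
    unfolding contains_pattern_def by (elim exE conjE) (rule that, intro conjI, assumption+)
  then have X: "X \<subseteq> verts G" and bij: "bij_betw f (pverts P) X"
    and ord: "\<And>x y. x \<in> pverts P \<Longrightarrow> y \<in> pverts P \<Longrightarrow> (x, y) \<in> pord P \<longleftrightarrow> (f x, f y) \<in> vord G"
    and mand: "\<And>e. e \<in> mandatory P \<Longrightarrow> f ` e \<in> edges G"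
    and forb: "\<And>e. e \<in> forbidden P \<Longrightarrow> f ` e \<notin> edges G"
    by blast+
  have "\<exists>a < length vs. vs ! a = f (ps ! p)" if "p < length ps" for p
  proof -
    have "ps ! p \<in> pverts P" using nth_mem[OF that] ps(2) by simp
    then have "f (ps ! p) \<in> set vs" using X bij vs by (auto simp: bij_betw_def)
    then show ?thesis by (simp add: in_set_conv_nth)
  qed
  then obtain g where g: "\<And>p. p < length ps \<Longrightarrow> g p < length vs \<and> vs ! g p = f (ps ! p)"
    by metis
  have "compatible P ps G vs p q (g p) (g q)" if "p < q" "q < length ps" for p q
  proof -
    have p: "p < length ps" using that by simp
    have in_P: "ps ! p \<in> pverts P" "ps ! q \<in> pverts P" 
      using nth_mem[OF p] nth_mem[OF that(2)] ps(2) by simp_all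
    have ne: "ps ! p \<noteq> ps ! q" using ps p that by (simp add: nth_eq_iff_index_eq)
    have "(f (ps ! p), f (ps ! q)) \<in> vord G"
      using ord[OF in_P] pord_nth_iff[OF p that(2)] that(1) by simp
    then have "g p \<le> g q" using g[OF p] g[OF that(2)] vord_nth_iff by metis
    \<comment> \<open>Order preservation gives only \<open>g p \<le> g q\<close>; injectivity of
      \<open>f\<close> makes it strict.\<close>
    moreover have "f (ps ! p) \<noteq> f (ps ! q)"
      using bij ne in_P by (auto simp: bij_betw_def inj_on_def)
    then have "g p \<noteq> g q" using g[OF p] g[OF that(2)] by metis
    ultimately show ?thesis
      using g[OF p] g[OF that(2)] mand[of "{ps ! p, ps ! q}"] forb[of "{ps ! p, ps ! q}"]
      by (auto simp: compatible_def)
  qed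
  with g have "pairwise_compatible P ps G vs g" by (simp add: pairwise_compatible_def)
  then show "\<exists>g. pairwise_compatible P ps G vs g" by blast
next
  have ps: "distinct ps" "set ps = pverts P" and vs: "distinct vs" "set vs = verts G"
    using P(2) G(2) by (auto simp: enumerates_def)
  assume "\<exists>g. pairwise_compatible P ps G vs g"
  then obtain g where "pairwise_compatible P ps G vs g" by blast
  then have g: "\<And>p. p < length ps \<Longrightarrow> g p < length vs"
    and compat: "\<And>p q. p < q \<Longrightarrow> q < length ps \<Longrightarrow> compatible P ps G vs p q (g p) (g q)"
    by (auto simp: pairwise_compatible_def)
  \<comment> \<open>Strict increase between linear orders also reflects the order, as the
    equivalence in \<open>contains_pattern\<close> demands.\<close>
  have mono: "g p \<le> g q \<longleftrightarrow> p \<le> q" if "p < length ps" "q < length ps" for p q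
    using compat[of p q] compat[of q p] that
    by (cases p q rule: linorder_cases) (auto simp: compatible_def)
  have "\<exists>p < length ps. ps ! p = x" if "x \<in> pverts P" for x
    using that ps(2) in_set_conv_nth[of x ps] by auto
  then obtain idx where idx: "\<And>x. x \<in> pverts P \<Longrightarrow> idx x < length ps \<and> ps ! idx x = x"
    by metis
  define f where "f x = vs ! g (idx x)" for x
  have order: "(x, y) \<in> pord P \<longleftrightarrow> (f x, f y) \<in> vord G"
    if "x \<in> pverts P" "y \<in> pverts P" for x y
    using pord_nth_iff[of "idx x" "idx y"] vord_nth_iff[of "g (idx x)" "g (idx y)"]
      mono[of "idx x" "idx y"] idx[OF that(1)] idx[OF that(2)] g
    by (simp add: f_def)
  have inj: "inj_on f (pverts P)"
  proof (rule inj_onI)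
    fix x y
    assume xy: "x \<in> pverts P" "y \<in> pverts P" "f x = f y"
    then have "g (idx x) = g (idx y)"
      using idx g vs(1) by (simp add: f_def nth_eq_iff_index_eq)
    then have "idx x = idx y" using mono idx xy(1,2) by (metis antisym order.refl)
    then show "x = y" using idx xy(1,2) by metis
  qed
  have sub: "f ` pverts P \<subseteq> verts G"
  proof
    fix v
    assume "v \<in> f ` pverts P"
    then obtain x where "x \<in> pverts P" "v = vs ! g (idx x)" by (auto simp: f_def)
    then show "v \<in> verts G" using idx g vs(2) nth_mem by metis
  qed
  have pair: "(e \<in> mandatory P \<longrightarrow> f ` e \<in> edges G) \<and> (e \<in> forbidden P \<longrightarrow> f ` e \<notin> edges G)"
    if e: "e \<in> [pverts P]\<^bsup>2\<^esup>" for e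
  proof -
    from e obtain x y where xy: "e = {x, y}" "x \<in> pverts P" "y \<in> pverts P" "x \<noteq> y"
      by (auto elim: nsets2_E)
    then have "idx x \<noteq> idx y" using idx by metis
    \<comment> \<open>The unordered pair is oriented by index, since compatibility is available only
      for increasing positions.\<close>
    then obtain x y where xy: "e = {x, y}" "x \<in> pverts P" "y \<in> pverts P" "idx x < idx y"
      using xy by (metis insert_commute linorder_neqE_nat)
    then show ?thesis
      using compat[of "idx x" "idx y"] idx[of x] idx[of y] by (auto simp: compatible_def f_def)
  qed
  show "contains_pattern G P"
    unfolding contains_pattern_def
  proof (intro exI conjI ballI)
    show "f ` pverts P \<subseteq> verts G" by (rule sub)
    show "bij_betw f (pverts P) (f ` pverts P)" using inj by (rule inj_on_imp_bij_betw)
    show "card (f ` pverts P) = card (pverts P)" using inj by (rule card_image)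
    show "\<And>e. e \<in> mandatory P \<Longrightarrow> f ` e \<in> edges G" "\<And>e. e \<in> forbidden P \<Longrightarrow> f ` e \<notin> edges G"
      using pair P(1) by (auto simp: is_pattern_def)
  qed (rule order)
qed

end

theorem theorem3:
  fixes P :: "'p pattern" and k :: nat
  assumes "is_pattern P" and "card (pverts P) = k"
  shows "\<exists>\<rho> :: 'a ordered_graph \<Rightarrow> nat graph. reduction \<rho> \<and>
    (\<forall>G n. is_ordered_graph G \<longrightarrow> card (verts G) = n \<longrightarrow>
       card (verts (\<rho> G)) = k * n \<and>
       (contains_pattern G P \<longleftrightarrow> contains_clique (\<rho> G) k))"
proof -
  obtain ps where ps: "enumerates ps (pverts P)" "sorted_wrt (\<lambda>p q. (p, q) \<in> pord P) ps"
    using exists_sorted_list[of "pverts P" "pverts P" "pord P"] assms(1)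
    by (auto simp: is_pattern_def)
  then have k: "length ps = k"
    using assms(2) by (metis enumerates_def distinct_card)
  define listing where "listing G vs \<longleftrightarrow>
    enumerates vs (verts G) \<and> sorted_wrt (\<lambda>u v. (u, v) \<in> vord G) vs"
    for G :: "'a ordered_graph" and vs
  \<comment> \<open>The map has to be a function of \<open>G\<close> alone, so an increasing
    enumeration is chosen; by uniqueness it is the one presented to the program.\<close>
  define \<rho> where "\<rho> G = blowup P ps G (SOME vs. listing G vs)" for G :: "'a ordered_graph"
  have listing: "\<exists>vs. listing G vs" if "is_ordered_graph G" for G
    using exists_sorted_list[of "verts G" "verts G" "vord G"] that
    by (auto simp: is_ordered_graph_def simple_graph_def listing_def)
  have \<rho>: "\<rho> G = blowup P ps G vs" if "is_ordered_graph G" "listing G vs" for G vs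
  proof -
    have "listing G (SOME vs. listing G vs)" using that(2) by (rule someI)
    then have "(SOME vs. listing G vs) = vs"
      using that
      by (intro sorted_list_unique[of "vord G"])
        (auto simp: listing_def enumerates_def is_ordered_graph_def order_on_defs)
    then show ?thesis by (simp add: \<rho>_def)
  qed
  have length_listing: "length vs = card (verts G)" if "listing G vs" for G vs
    using that by (metis listing_def enumerates_def distinct_card)
  have "mandatory P \<inter> forbidden P = {}" using assms(1) by (simp add: is_pattern_def)
  from blowup_computable[OF this, of ps] obtain c C where
    run: "\<And>(G :: 'a ordered_graph) vs. \<exists>t s. exec c (input_state G vs) t s \<and>
      output_state s (blowup P ps G vs) \<and> t \<le> C * ((length vs)\<^sup>2 + 1)"
    by metis
  have "\<exists>t s. exec c (input_state G vs) t s \<and> output_state s (\<rho> G) \<and>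
        t \<le> C * ((card (verts G))\<^sup>2 + 1)"
    if "is_ordered_graph G" "enumerates vs (verts G)" "sorted_wrt (\<lambda>u v. (u, v) \<in> vord G) vs"
    for G :: "'a ordered_graph" and vs
  proof -
    have "listing G vs" using that by (simp add: listing_def)
    then show ?thesis using run[of G vs] length_listing \<rho>[OF that(1)] by simp
  qed
  moreover have "simple_graph (\<rho> G)" for G by (simp add: \<rho>_def simple_graph_blowup)
  ultimately have "reduction \<rho>" unfolding reduction_def by blast
  moreover have "card (verts (\<rho> G)) = k * card (verts G) \<and>
      (contains_pattern G P \<longleftrightarrow> contains_clique (\<rho> G) k)" if G: "is_ordered_graph G" for G
  proof -
    obtain vs where vs: "listing G vs" using listing[OF G] by blast
    then have "enumerates vs (verts G)" "sorted_wrt (\<lambda>u v. (u, v) \<in> vord G) vs"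
      by (auto simp: listing_def)
    note hyps = assms(1) ps G this
    have "card (verts (\<rho> G)) = k * card (verts G)"
      using \<rho>[OF G vs] length_listing[OF vs] k by (simp add: blowup_def)
    moreover have "contains_pattern G P \<longleftrightarrow> contains_clique (\<rho> G) k"
      using contains_pattern_iff_compatible[OF hyps] contains_clique_iff_compatible[of P ps G vs]
        \<rho>[OF G vs] k by simp
    ultimately show ?thesis by blast
  qed
  ultimately show ?thesis by blast
qed

end
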